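(* Let $S$ denote the salinity difference. The system $\frac{dS}{dt}=f(S,\theta,P)$ governed by the dynamics $$f(S,\theta,P)=P-S\left[1+\beta(\theta-\lambda S)^2\right]$$ exhibits a cusp bifurcation at the unique parameter point $$(\theta_{\mathrm{cusp}},P_{\mathrm{cusp}})=\left(\sqrt{\frac{3}{\beta}},\ \frac{8}{3\lambda\sqrt{3\beta}}\right).$$ This point marks the boundary in parameter space separating the regime of hysteresis from the regime of monotonic stability.
   Context: The equation is a reduced (one-dimensional) two-box model of thermohaline circulation: $S$ is the salinity difference between the two boxes, and the two parameters being varied are $\theta$, the equilibrium temperature difference between the boxes, and $P$, the freshwater forcing. The constants $\beta>0$ and $\lambda>0$ are fixed physical constants ($\lambda$ is the ratio of the haline contraction coefficient to the thermal expansion coefficient). A cusp bifurcation at a parameter point $(\theta,P)$ means that for some $S$ the three conditions $f=0$ (equilibrium), $\frac{\partial f}{\partial S}=0$ (vanishing linear stability) and $\frac{\partial^2 f}{\partial S^2}=0$ (vanishing curvature) hold simultaneously, together with the non-degeneracy condition $\frac{\partial^3 f}{\partial S^3}\neq 0$. It is the point at which the two saddle-node bifurcations bounding the hysteresis loop merge and the loop collapses.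
   Formalization: The temperature difference θ is restricted to θ ≥ 0: by the symmetry (S,θ,P) → (−S,−θ,−P), the point (−θ_cusp, −P_cusp) is also a cusp, so uniqueness fails over all real θ. *)

theory Defs
  imports "HOL-Analysis.Analysis"
begin

text \<open>The parameter \<open>lam\<close> is the constant lambda, whose symbol is reserved for abstraction.\<close>

definition two_box :: "real \<Rightarrow> real \<Rightarrow> real \<Rightarrow> real \<Rightarrow> real \<Rightarrow> real" where
  "two_box \<beta> lam S \<theta> P = P - S * (1 + \<beta> * (\<theta> - lam * S)\<^sup>2)"

text \<open>
  Below, \<open>f S \<theta> P\<close> is the right-hand side of a scalar system \<open>dS/dt = f(S, \<theta>, P)\<close>. Partial
  derivatives are taken with \<^const>\<open>deriv\<close>, so the notions are meant for smooth \<open>f\<close>.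
\<close>

definition dS :: "nat \<Rightarrow> (real \<Rightarrow> real \<Rightarrow> real \<Rightarrow> real) \<Rightarrow> real \<Rightarrow> real \<Rightarrow> real \<Rightarrow> real" where
  "dS k f S \<theta> P = (deriv ^^ k) (\<lambda>s. f s \<theta> P) S"

definition equilibrium :: "(real \<Rightarrow> real \<Rightarrow> real \<Rightarrow> real) \<Rightarrow> real \<Rightarrow> real \<Rightarrow> real \<Rightarrow> bool" where
  "equilibrium f \<theta> P S \<longleftrightarrow> f S \<theta> P = 0"

definition stable_equilibrium :: "(real \<Rightarrow> real \<Rightarrow> real \<Rightarrow> real) \<Rightarrow> real \<Rightarrow> real \<Rightarrow> real \<Rightarrow> bool" where
  "stable_equilibrium f \<theta> P S \<longleftrightarrow> equilibrium f \<theta> P S \<and> dS 1 f S \<theta> P < 0"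

definition unstable_equilibrium :: "(real \<Rightarrow> real \<Rightarrow> real \<Rightarrow> real) \<Rightarrow> real \<Rightarrow> real \<Rightarrow> real \<Rightarrow> bool" where
  "unstable_equilibrium f \<theta> P S \<longleftrightarrow> equilibrium f \<theta> P S \<and> dS 1 f S \<theta> P > 0"

definition cusp_bifurcation :: "(real \<Rightarrow> real \<Rightarrow> real \<Rightarrow> real) \<Rightarrow> real \<Rightarrow> real \<Rightarrow> bool" where
  "cusp_bifurcation f \<theta> P \<longleftrightarrow>
     (\<exists>S. f S \<theta> P = 0 \<and> dS 1 f S \<theta> P = 0 \<and> dS 2 f S \<theta> P = 0 \<and> dS 3 f S \<theta> P \<noteq> 0)"

text \<open>Saddle-node (fold) at the state \<open>S\<close> when \<open>P\<close> is varied at fixed \<open>\<theta>\<close>.\<close>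

definition saddle_node :: "(real \<Rightarrow> real \<Rightarrow> real \<Rightarrow> real) \<Rightarrow> real \<Rightarrow> real \<Rightarrow> real \<Rightarrow> bool" where
  "saddle_node f \<theta> P S \<longleftrightarrow>
     f S \<theta> P = 0 \<and> dS 1 f S \<theta> P = 0 \<and> dS 2 f S \<theta> P \<noteq> 0 \<and> deriv (\<lambda>p. f S \<theta> p) P \<noteq> 0"

text \<open>
  Hysteresis loop under variation of \<open>P\<close> at fixed \<open>\<theta>\<close>: the lower stable branch exists for
  \<open>P < Phi\<close> and ends in the fold \<open>(Phi, Slo)\<close>, the upper one exists for \<open>P > Plo\<close> and ends in
  the fold \<open>(Plo, Shi)\<close>. Between the folds both coexist, separated by an unstable equilibrium;
  beyond either fold only one of them remains, so the state jumps there.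
\<close>

definition hysteresis_loop :: "(real \<Rightarrow> real \<Rightarrow> real \<Rightarrow> real) \<Rightarrow> real \<Rightarrow> real \<Rightarrow> real \<Rightarrow> bool" where
  "hysteresis_loop f \<theta> Plo Phi \<longleftrightarrow> Plo < Phi \<and>
     (\<exists>Slo Shi. Slo < Shi \<and> saddle_node f \<theta> Phi Slo \<and> saddle_node f \<theta> Plo Shi \<and>
        (\<forall>P. Plo < P \<and> P < Phi \<longrightarrow>
           (\<exists>a b c. a < Slo \<and> Slo < b \<and> b < Shi \<and> Shi < c \<and>
              {S. equilibrium f \<theta> P S} = {a, b, c} \<and>
              stable_equilibrium f \<theta> P a \<and> unstable_equilibrium f \<theta> P b \<and>
              stable_equilibrium f \<theta> P c)) \<and>
        (\<forall>P < Plo. \<exists>a < Slo. {S. equilibrium f \<theta> P S} = {a} \<and> stable_equilibrium f \<theta> P a) \<and>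
        (\<forall>P > Phi. \<exists>c > Shi. {S. equilibrium f \<theta> P S} = {c} \<and> stable_equilibrium f \<theta> P c))"

definition hysteretic :: "(real \<Rightarrow> real \<Rightarrow> real \<Rightarrow> real) \<Rightarrow> real \<Rightarrow> bool" where
  "hysteretic f \<theta> \<longleftrightarrow> (\<exists>Plo Phi. hysteresis_loop f \<theta> Plo Phi)"

definition monotonically_stable :: "(real \<Rightarrow> real \<Rightarrow> real \<Rightarrow> real) \<Rightarrow> real \<Rightarrow> bool" where
  "monotonically_stable f \<theta> \<longleftrightarrow>
     (\<exists>E. strict_mono E \<and>
        (\<forall>P. {S. equilibrium f \<theta> P S} = {E P} \<and> stable_equilibrium f \<theta> P (E P)))"

text \<open>
  The regimes as sets of parameter points \<open>(\<theta>, P)\<close>. The temperature difference \<open>\<theta>\<close> is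
  nonnegative; \<open>two_box\<close> is odd under \<open>(S, \<theta>, P) \<mapsto> (-S, -\<theta>, -P)\<close>, so without this convention
  every bifurcation would occur twice.
\<close>

definition hysteresis_regime :: "(real \<Rightarrow> real \<Rightarrow> real \<Rightarrow> real) \<Rightarrow> (real \<times> real) set" where
  "hysteresis_regime f =
     {(\<theta>, P). 0 \<le> \<theta> \<and> (\<exists>Plo Phi. hysteresis_loop f \<theta> Plo Phi \<and> Plo < P \<and> P < Phi)}"

definition monotonic_regime :: "(real \<Rightarrow> real \<Rightarrow> real \<Rightarrow> real) \<Rightarrow> (real \<times> real) set" where
  "monotonic_regime f = {(\<theta>, P). 0 \<le> \<theta> \<and> monotonically_stable f \<theta>}"

end

theory Submission
  imports Defs
begin

text \<open>
  At fixed \<open>\<theta>\<close> the equilibria for the forcing \<open>P\<close> are the solutions of \<open>P = g(S)\<close> with the cubic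
  \<open>g(S) = S (1 + \<beta> (\<theta> - \<lambda> S)\<^sup>2)\<close>, and stability is the sign of \<open>g'\<close>. The discriminant of the quadratic
  \<open>g'\<close> has the sign of \<open>\<theta>\<^sup>2 - 3/\<beta>\<close>: below the critical \<open>\<theta>\<close> the cubic is an increasing bijection,
  above it \<open>g\<close> has two critical points, whose values are the fold values of \<open>P\<close>, and these
  merge continuously in the cusp as \<open>\<theta>\<close> decreases to \<open>\<surd>(3/\<beta>)\<close>. A hysteresis loop at \<open>\<theta>\<close> is therefore
  unique, and the closure of the hysteresis regime meets the critical line only in the cusp.
\<close>

section \<open>The equilibrium cubic and the derivatives of the vector field\<close>

definition forcing :: "real \<Rightarrow> real \<Rightarrow> real \<Rightarrow> real \<Rightarrow> real" where
  "forcing \<beta> lam \<theta> S = S * (1 + \<beta> * (\<theta> - lam * S)\<^sup>2)"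

definition slope :: "real \<Rightarrow> real \<Rightarrow> real \<Rightarrow> real \<Rightarrow> real" where
  "slope \<beta> lam \<theta> S = 1 + \<beta> * \<theta>\<^sup>2 - 4 * \<beta> * \<theta> * lam * S + 3 * \<beta> * lam\<^sup>2 * S\<^sup>2"

text \<open>The smaller root of \<open>slope\<close> once
  \<open>3 / \<beta> \<le> \<theta>\<^sup>2\<close>; \<open>fold_hi\<close> is the larger one. The
  real \<open>sqrt\<close> is total and continuous, so both formulas make sense and are continuous
  for every \<open>\<theta>\<close>, although below the threshold they are no longer roots.\<close>

definition fold_lo :: "real \<Rightarrow> real \<Rightarrow> real \<Rightarrow> real" where
  "fold_lo \<beta> lam \<theta> = (2 * \<theta> - sqrt (\<theta>\<^sup>2 - 3 / \<beta>)) / (3 * lam)"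

definition fold_hi :: "real \<Rightarrow> real \<Rightarrow> real \<Rightarrow> real" where
  "fold_hi \<beta> lam \<theta> = (2 * \<theta> + sqrt (\<theta>\<^sup>2 - 3 / \<beta>)) / (3 * lam)"

lemma two_box_forcing: "two_box \<beta> lam S \<theta> P = P - forcing \<beta> lam \<theta> S"
  by (simp add: two_box_def forcing_def)

lemma equilibrium_iff_forcing: "equilibrium (two_box \<beta> lam) \<theta> P S \<longleftrightarrow> forcing \<beta> lam \<theta> S = P"
  by (auto simp: equilibrium_def two_box_forcing)

lemma has_real_derivative_forcing:
  "(forcing \<beta> lam \<theta> has_real_derivative slope \<beta> lam \<theta> S) (at S)"
  unfolding forcing_def slope_def
  by (auto intro!: derivative_eq_intros simp: power2_eq_square algebra_simps)

lemma continuous_on_forcing: "continuous_on A (forcing \<beta> lam \<theta>)"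
  unfolding forcing_def by (intro continuous_intros)

lemma deriv_two_box: "deriv (\<lambda>s. two_box \<beta> lam s \<theta> P) = (\<lambda>s. - slope \<beta> lam \<theta> s)"
  unfolding two_box_forcing
  by (intro ext DERIV_imp_deriv)
    (auto intro!: derivative_eq_intros has_real_derivative_forcing)

lemma deriv_slope: "deriv (\<lambda>s. - slope \<beta> lam \<theta> s) = (\<lambda>s. 4 * \<beta> * \<theta> * lam - 6 * \<beta> * lam\<^sup>2 * s)"
  unfolding slope_def
  by (intro ext DERIV_imp_deriv) (auto intro!: derivative_eq_intros)

lemma dS1_two_box: "dS 1 (two_box \<beta> lam) S \<theta> P = - slope \<beta> lam \<theta> S"
  by (simp add: dS_def deriv_two_box)

lemma dS2_two_box: "dS 2 (two_box \<beta> lam) S \<theta> P = 4 * \<beta> * \<theta> * lam - 6 * \<beta> * lam\<^sup>2 * S"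
  by (simp add: dS_def numeral_2_eq_2 deriv_two_box deriv_slope)

lemma dS3_two_box: "dS 3 (two_box \<beta> lam) S \<theta> P = - 6 * \<beta> * lam\<^sup>2"
proof -
  have "deriv (\<lambda>s. 4 * \<beta> * \<theta> * lam - 6 * \<beta> * lam\<^sup>2 * s) S = - 6 * \<beta> * lam\<^sup>2"
    by (intro DERIV_imp_deriv) (auto intro!: derivative_eq_intros)
  then show ?thesis
    by (simp add: dS_def numeral_3_eq_3 deriv_two_box deriv_slope)
qed

lemma stable_equilibrium_two_box:
  "stable_equilibrium (two_box \<beta> lam) \<theta> P S \<longleftrightarrow> forcing \<beta> lam \<theta> S = P \<and> slope \<beta> lam \<theta> S > 0"
  unfolding stable_equilibrium_def dS1_two_box equilibrium_iff_forcing by simp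

lemma unstable_equilibrium_two_box:
  "unstable_equilibrium (two_box \<beta> lam) \<theta> P S \<longleftrightarrow> forcing \<beta> lam \<theta> S = P \<and> slope \<beta> lam \<theta> S < 0"
  unfolding unstable_equilibrium_def dS1_two_box equilibrium_iff_forcing by simp

lemma saddle_node_two_box:
  "saddle_node (two_box \<beta> lam) \<theta> P S \<longleftrightarrow>
     forcing \<beta> lam \<theta> S = P \<and> slope \<beta> lam \<theta> S = 0 \<and> 4 * \<beta> * \<theta> * lam - 6 * \<beta> * lam\<^sup>2 * S \<noteq> 0"
proof -
  \<comment> \<open>\<open>P\<close> enters the field additively, which settles the transversality
    condition.\<close>
  have "deriv (\<lambda>p. two_box \<beta> lam S \<theta> p) P = 1"
    unfolding two_box_forcing by (intro DERIV_imp_deriv) (auto intro!: derivative_eq_intros)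
  then show ?thesis
    unfolding saddle_node_def dS1_two_box dS2_two_box two_box_forcing by auto
qed

section \<open>Monotone pieces and range of the cubic\<close>

lemma strictly_increasing_if_slope_pos:
  assumes "a < b" "\<And>x. a < x \<Longrightarrow> x < b \<Longrightarrow> slope \<beta> lam \<theta> x > 0"
  shows "forcing \<beta> lam \<theta> a < forcing \<beta> lam \<theta> b"
  \<comment> \<open>The sign is required on the open interval only, so an endpoint may be a fold,
    where the slope vanishes.\<close>
  using assms has_real_derivative_forcing continuous_on_forcing
  by (intro DERIV_pos_imp_increasing_open[of a b "forcing \<beta> lam \<theta>"]) blast+

lemma strictly_decreasing_if_slope_neg:
  assumes "a < b" "\<And>x. a < x \<Longrightarrow> x < b \<Longrightarrow> slope \<beta> lam \<theta> x < 0"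
  shows "forcing \<beta> lam \<theta> b < forcing \<beta> lam \<theta> a"
  using assms has_real_derivative_forcing continuous_on_forcing
  by (intro DERIV_neg_imp_decreasing_open[of a b "forcing \<beta> lam \<theta>"]) blast+

text \<open>The factor multiplying \<open>S\<close> is at least 1. This bound and its mirror image
  stand in for the limits at infinity when the intermediate value theorem is applied.\<close>

lemma forcing_ge:
  assumes "\<beta> > 0" "0 \<le> S"
  shows "S \<le> forcing \<beta> lam \<theta> S"
  using assms by (simp add: forcing_def distrib_left)

lemma forcing_le:
  assumes "\<beta> > 0" "S \<le> 0"
  shows "forcing \<beta> lam \<theta> S \<le> S"
  using assms by (simp add: forcing_def distrib_left mult_nonpos_nonneg)

lemma forcing_attains_above:
  assumes "\<beta> > 0" "forcing \<beta> lam \<theta> c < P"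
  obtains S where "c < S" "forcing \<beta> lam \<theta> S = P"
proof -
  \<comment> \<open>A right endpoint that lies beyond \<open>c\<close> and is at least
    \<open>\<bar>P\<bar>\<close>, so that \<open>forcing_ge\<close> pushes the cubic up to
    \<open>P\<close> there.\<close>
  let ?m = "max c \<bar>P\<bar>"
  have "P \<le> forcing \<beta> lam \<theta> ?m"
    using forcing_ge[OF assms(1), of ?m lam \<theta>] by linarith
  moreover have "c \<le> ?m" by simp
  ultimately obtain S where "c \<le> S" "forcing \<beta> lam \<theta> S = P"
    using IVT'[of "forcing \<beta> lam \<theta>" c P ?m] assms(2) continuous_on_forcing less_imp_le by blast
  with assms(2) show thesis by (intro that[of S]) (auto simp: less_le)
qed

lemma forcing_attains_below:
  assumes "\<beta> > 0" "P < forcing \<beta> lam \<theta> c"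
  obtains S where "S < c" "forcing \<beta> lam \<theta> S = P"
proof -
  let ?m = "min c (- \<bar>P\<bar>)"
  have "forcing \<beta> lam \<theta> ?m \<le> P"
    using forcing_le[OF assms(1), of ?m lam \<theta>] by linarith
  moreover have "?m \<le> c" by simp
  ultimately obtain S where "S \<le> c" "forcing \<beta> lam \<theta> S = P"
    using IVT'[of "forcing \<beta> lam \<theta>" ?m P c] assms(2) continuous_on_forcing less_imp_le by blast
  with assms(2) show thesis by (intro that[of S]) (auto simp: less_le)
qed

lemma forcing_attains:
  assumes "\<beta> > 0"
  obtains S where "forcing \<beta> lam \<theta> S = P"
  using forcing_attains_above[OF assms, of lam \<theta> 0 P] forcing_attains_below[OF assms, of P lam \<theta> 0]
  by (metis linorder_neqE_linordered_idom)

section \<open>Discriminant and roots of the slope\<close>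

lemma slope_complete_square:
  assumes "\<beta> > 0"
  shows "slope \<beta> lam \<theta> S = 3 * \<beta> * ((lam * S - 2 * \<theta> / 3)\<^sup>2 - (\<theta>\<^sup>2 - 3 / \<beta>) / 9)"
  using assms by (simp add: slope_def power2_eq_square field_simps)

lemma slope_pos:
  assumes "\<beta> > 0" "\<theta>\<^sup>2 < 3 / \<beta>"
  shows "slope \<beta> lam \<theta> S > 0"
proof -
  have "(\<theta>\<^sup>2 - 3 / \<beta>) / 9 < 0" using assms(2) by simp
  also have "0 \<le> (lam * S - 2 * \<theta> / 3)\<^sup>2" by simp
  finally show ?thesis
    unfolding slope_complete_square[OF assms(1)] using assms(1) by (intro mult_pos_pos) simp_all
qed

text \<open>Difference of two squares, applied to the completed square. The case of equality is
  included: there the two roots coincide.\<close>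

lemma slope_factor:
  assumes "\<beta> > 0" "lam > 0" "3 / \<beta> \<le> \<theta>\<^sup>2"
  shows "slope \<beta> lam \<theta> S = 3 * \<beta> * lam\<^sup>2 * ((S - fold_lo \<beta> lam \<theta>) * (S - fold_hi \<beta> lam \<theta>))"
proof -
  define r where "r = sqrt (\<theta>\<^sup>2 - 3 / \<beta>)"
  have r: "r * r = \<theta>\<^sup>2 - 3 / \<beta>" using assms by (simp add: r_def)
  have "lam\<^sup>2 * ((S - fold_lo \<beta> lam \<theta>) * (S - fold_hi \<beta> lam \<theta>))
      = (lam * S - (2 * \<theta> - r) / 3) * (lam * S - (2 * \<theta> + r) / 3)"
    using assms unfolding fold_lo_def fold_hi_def r_def[symmetric]
    by (simp add: power2_eq_square field_simps)
  also have "\<dots> = (lam * S - 2 * \<theta> / 3)\<^sup>2 - r * r / 9"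
    by (simp add: power2_eq_square field_simps)
  finally show ?thesis
    unfolding slope_complete_square[OF assms(1)] r by (simp add: mult.assoc)
qed

lemma fold_lo_less_fold_hi_iff:
  assumes "lam > 0"
  shows "fold_lo \<beta> lam \<theta> < fold_hi \<beta> lam \<theta> \<longleftrightarrow> 3 / \<beta> < \<theta>\<^sup>2"
  using assms by (simp add: fold_lo_def fold_hi_def divide_less_cancel)

section \<open>Cusp points and monotonic stability\<close>

lemma cusp_bifurcation_two_box_iff:
  assumes "\<beta> > 0" "lam > 0"
  shows "cusp_bifurcation (two_box \<beta> lam) \<theta> P \<longleftrightarrow>
    \<theta>\<^sup>2 = 3 / \<beta> \<and> P = forcing \<beta> lam \<theta> (2 * \<theta> / (3 * lam))"
proof -
  \<comment> \<open>The second derivative is linear in \<open>S\<close>, so it fixes the state as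
    the inflection point of the cubic. The slope condition there then fixes
    \<open>\<theta>\<^sup>2\<close>, and the equilibrium condition fixes \<open>P\<close>.\<close>
  have inflection: "4 * \<beta> * \<theta> * lam - 6 * \<beta> * lam\<^sup>2 * S = 0 \<longleftrightarrow> S = 2 * \<theta> / (3 * lam)" for S
    using assms by (auto simp: power2_eq_square field_simps)
  have "slope \<beta> lam \<theta> (2 * \<theta> / (3 * lam)) = 0 \<longleftrightarrow> \<theta>\<^sup>2 = 3 / \<beta>"
    using assms by (auto simp: slope_complete_square)
  then show ?thesis
    unfolding cusp_bifurcation_def dS1_two_box dS2_two_box dS3_two_box two_box_forcing inflection
    using assms by auto
qed

lemma monotonically_stable_two_box_iff:
  assumes "\<beta> > 0" "lam > 0"
  shows "monotonically_stable (two_box \<beta> lam) \<theta> \<longleftrightarrow> \<theta>\<^sup>2 < 3 / \<beta>"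
proof
  assume "monotonically_stable (two_box \<beta> lam) \<theta>"
  then obtain E where E: "\<And>P. {S. forcing \<beta> lam \<theta> S = P} = {E P}"
      "\<And>P. slope \<beta> lam \<theta> (E P) > 0"
    unfolding monotonically_stable_def stable_equilibrium_two_box equilibrium_iff_forcing by metis
  \<comment> \<open>Every state \<open>S\<close> is an equilibrium for the forcing
    \<open>forcing \<beta> lam \<theta> S\<close>, hence the stable one. So the slope is positive
    everywhere, whereas from the critical \<theta> on it would vanish at
    \<open>fold_lo\<close>.\<close>
  have pos: "slope \<beta> lam \<theta> S > 0" for S
    using E(1)[of "forcing \<beta> lam \<theta> S"] E(2)[of "forcing \<beta> lam \<theta> S"]
    by (metis (mono_tags, lifting) mem_Collect_eq singletonD)
  show "\<theta>\<^sup>2 < 3 / \<beta>"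
    using pos[of "fold_lo \<beta> lam \<theta>"] slope_factor[OF assms, of \<theta> "fold_lo \<beta> lam \<theta>"]
    by force
next
  assume *: "\<theta>\<^sup>2 < 3 / \<beta>"
  note pos = slope_pos[OF assms(1) *]
  have mono: "forcing \<beta> lam \<theta> a < forcing \<beta> lam \<theta> b \<longleftrightarrow> a < b" for a b
    using strictly_increasing_if_slope_pos[OF _ pos]
    by (cases a b rule: linorder_cases) (auto dest: less_asym)
  obtain E where E: "\<And>P. forcing \<beta> lam \<theta> (E P) = P"
  \<comment> \<open>The cubic is onto, and \<open>E\<close> is chosen as its inverse. Strict
    monotonicity of the cubic makes \<open>E\<close> the only solution and passes to
    \<open>E\<close>.\<close>
  proof -
    have "\<forall>P. \<exists>S. forcing \<beta> lam \<theta> S = P"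
      by (meson forcing_attains[OF assms(1)])
    then show thesis using that by metis
  qed
  have "S = E P" if "forcing \<beta> lam \<theta> S = P" for S P
    using mono[of S "E P"] mono[of "E P" S] that E[of P]
    by (cases S "E P" rule: linorder_cases) auto
  then have "{S. forcing \<beta> lam \<theta> S = P} = {E P}" for P
    using E by blast
  moreover have "strict_mono E"
    using mono[of "E P" "E Q" for P Q] by (intro strict_monoI) (simp add: E)
  ultimately show "monotonically_stable (two_box \<beta> lam) \<theta>"
    unfolding monotonically_stable_def stable_equilibrium_two_box equilibrium_iff_forcing
    using E pos by blast
qed

section \<open>Hysteresis loops\<close>

lemma hysteresis_loop_two_boxD:
  assumes "\<beta> > 0" "lam > 0" "hysteresis_loop (two_box \<beta> lam) \<theta> Plo Phi"
  shows "3 / \<beta> < \<theta>\<^sup>2" "Plo = forcing \<beta> lam \<theta> (fold_hi \<beta> lam \<theta>)"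
    "Phi = forcing \<beta> lam \<theta> (fold_lo \<beta> lam \<theta>)"
proof -
  obtain Slo Shi where S: "Slo < Shi" "slope \<beta> lam \<theta> Slo = 0" "slope \<beta> lam \<theta> Shi = 0"
      "forcing \<beta> lam \<theta> Slo = Phi" "forcing \<beta> lam \<theta> Shi = Plo"
    using assms(3) unfolding hysteresis_loop_def saddle_node_two_box by blast
  have le: "3 / \<beta> \<le> \<theta>\<^sup>2"
    using slope_pos[OF assms(1), of \<theta> lam Slo] S(2) by force
  have ord: "fold_lo \<beta> lam \<theta> \<le> fold_hi \<beta> lam \<theta>"
    using assms le by (simp add: fold_lo_def fold_hi_def divide_right_mono)
  \<comment> \<open>The two folds of a loop are distinct zeros of the quadratic
    \<open>slope\<close>, so their order identifies them with its two roots.\<close>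
  have "Slo = fold_lo \<beta> lam \<theta>" "Shi = fold_hi \<beta> lam \<theta>"
    using S(1-3) ord assms slope_factor[OF assms(1,2) le] by auto
  then show "3 / \<beta> < \<theta>\<^sup>2" "Plo = forcing \<beta> lam \<theta> (fold_hi \<beta> lam \<theta>)"
    "Phi = forcing \<beta> lam \<theta> (fold_lo \<beta> lam \<theta>)"
    using S fold_lo_less_fold_hi_iff[OF assms(2)] by auto
qed

text \<open>The slope has signs plus, minus, plus on the three intervals cut out by its roots, so
  the cubic rises to a local maximum at \<open>fold_lo\<close>, falls to a local minimum at
  \<open>fold_hi\<close> and rises again. Each monotone piece carries one branch of
  equilibria.\<close>

lemma hysteresis_loop_two_box:
  assumes "\<beta> > 0" "lam > 0" "3 / \<beta> < \<theta>\<^sup>2"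
  shows "hysteresis_loop (two_box \<beta> lam) \<theta>
    (forcing \<beta> lam \<theta> (fold_hi \<beta> lam \<theta>)) (forcing \<beta> lam \<theta> (fold_lo \<beta> lam \<theta>))"
proof -
  define lo hi where "lo = fold_lo \<beta> lam \<theta>" and "hi = fold_hi \<beta> lam \<theta>"
  let ?g = "forcing \<beta> lam \<theta>"
  have lohi: "lo < hi"
    using assms fold_lo_less_fold_hi_iff by (simp add: lo_def hi_def)
  have slope: "slope \<beta> lam \<theta> S = 3 * \<beta> * lam\<^sup>2 * ((S - lo) * (S - hi))" for S
    using slope_factor[of \<beta> lam \<theta> S] assms by (simp add: lo_def hi_def)
  have coeff: "3 * \<beta> * lam\<^sup>2 > 0" using assms by simp
  have slope_left: "slope \<beta> lam \<theta> S > 0" if "S < lo" for S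
    unfolding slope using that lohi by (intro mult_pos_pos[OF coeff] mult_neg_neg) auto
  have slope_right: "slope \<beta> lam \<theta> S > 0" if "hi < S" for S
    unfolding slope using that lohi by (intro mult_pos_pos[OF coeff] mult_pos_pos) auto
  have slope_mid: "slope \<beta> lam \<theta> S < 0" if "lo < S" "S < hi" for S
    unfolding slope using that by (intro mult_pos_neg[OF coeff] mult_pos_neg) auto
  have left: "?g a < ?g b" if "a < b" "b \<le> lo" for a b
    using that slope_left by (intro strictly_increasing_if_slope_pos) auto
  have right: "?g a < ?g b" if "a < b" "hi \<le> a" for a b
    using that slope_right by (intro strictly_increasing_if_slope_pos) auto
  have mid: "?g b < ?g a" if "a < b" "lo \<le> a" "b \<le> hi" for a b
    using that slope_mid by (intro strictly_decreasing_if_slope_neg) auto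
  have folds: "?g hi < ?g lo" using mid[of lo hi] lohi by simp
  \<comment> \<open>These two one-sided bounds leave a single branch for forcings outside the fold
    values.\<close>
  have ge_hi: "?g hi \<le> ?g S" if "lo \<le> S" for S
    using mid[of S hi] right[of hi S] that by (cases S hi rule: linorder_cases) auto
  have le_lo: "?g S \<le> ?g lo" if "S \<le> hi" for S
    using mid[of lo S] left[of S lo] that by (cases S lo rule: linorder_cases) auto
  have inj_left: "a = b" if "?g a = ?g b" "a \<le> lo" "b \<le> lo" for a b
    using left[of a b] left[of b a] that by (cases a b rule: linorder_cases) auto
  have inj_right: "a = b" if "?g a = ?g b" "hi \<le> a" "hi \<le> b" for a b
    using right[of a b] right[of b a] that by (cases a b rule: linorder_cases) auto
  have inj_mid: "a = b" if "?g a = ?g b" "lo \<le> a" "a \<le> hi" "lo \<le> b" "b \<le> hi" for a b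
    using mid[of a b] mid[of b a] that by (cases a b rule: linorder_cases) auto
  \<comment> \<open>The second derivative of the field, obtained by differentiating the factored
    slope. At either root one summand vanishes and the other is plus or minus
    \<open>hi - lo\<close>, so both folds are nondegenerate.\<close>
  have "4 * \<beta> * \<theta> * lam - 6 * \<beta> * lam\<^sup>2 * S = - 3 * \<beta> * lam\<^sup>2 * ((S - lo) + (S - hi))" for S
    using assms(2) by (simp add: lo_def hi_def fold_lo_def fold_hi_def power2_eq_square field_simps)
  then have saddle: "saddle_node (two_box \<beta> lam) \<theta> (?g lo) lo"
      "saddle_node (two_box \<beta> lam) \<theta> (?g hi) hi"
    unfolding saddle_node_two_box slope using lohi assms by auto
  have between: "\<exists>a b c. a < lo \<and> lo < b \<and> b < hi \<and> hi < c \<and> {S. ?g S = P} = {a, b, c} \<and>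
      (?g a = P \<and> slope \<beta> lam \<theta> a > 0) \<and> (?g b = P \<and> slope \<beta> lam \<theta> b < 0) \<and>
      (?g c = P \<and> slope \<beta> lam \<theta> c > 0)" if P: "?g hi < P \<and> P < ?g lo" for P
  proof -
    obtain a where a: "a < lo" "?g a = P"
      using forcing_attains_below[OF assms(1)] P by blast
    obtain c where c: "hi < c" "?g c = P"
      using forcing_attains_above[OF assms(1)] P by blast
    obtain b where b: "lo \<le> b" "b \<le> hi" "?g b = P"
      using IVT2'[of ?g hi P lo] P lohi continuous_on_forcing by auto
    have b': "lo < b" "b < hi" using b P by (auto simp: less_le)
    \<comment> \<open>The three pieces, with their endpoints, cover the line, and the cubic is
      injective on each.\<close>
    have "S \<in> {a, b, c}" if "?g S = P" for S
      using inj_left[of S a] inj_mid[of S b] inj_right[of S c] that a b c by fastforce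
    then have "{S. ?g S = P} = {a, b, c}" using a b c by blast
    with a b b' c slope_left slope_mid slope_right show ?thesis by blast
  qed
  have below: "\<exists>a<lo. {S. ?g S = P} = {a} \<and> ?g a = P \<and> slope \<beta> lam \<theta> a > 0" if P: "P < ?g hi" for P
  proof -
    obtain a where a: "a < lo" "?g a = P"
      using forcing_attains_below[OF assms(1), of P lam \<theta> lo] P folds by auto
    have "S = a" if "?g S = P" for S
      using inj_left[of S a] ge_hi[of S] that a P by fastforce
    with a slope_left show ?thesis by blast
  qed
  have above: "\<exists>c>hi. {S. ?g S = P} = {c} \<and> ?g c = P \<and> slope \<beta> lam \<theta> c > 0" if P: "?g lo < P" for P
  proof -
    obtain c where c: "hi < c" "?g c = P"
      using forcing_attains_above[OF assms(1), of lam \<theta> hi P] P folds by auto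
    have "S = c" if "?g S = P" for S
      using inj_right[of S c] le_lo[of S] that c P by fastforce
    with c slope_right show ?thesis by blast
  qed
  show ?thesis
    unfolding hysteresis_loop_def stable_equilibrium_two_box unstable_equilibrium_two_box
      equilibrium_iff_forcing lo_def[symmetric] hi_def[symmetric]
    using folds lohi saddle between below above by blast
qed

lemma hysteresis_loop_two_box_iff:
  assumes "\<beta> > 0" "lam > 0"
  shows "hysteresis_loop (two_box \<beta> lam) \<theta> Plo Phi \<longleftrightarrow>
    3 / \<beta> < \<theta>\<^sup>2 \<and> Plo = forcing \<beta> lam \<theta> (fold_hi \<beta> lam \<theta>) \<and>
    Phi = forcing \<beta> lam \<theta> (fold_lo \<beta> lam \<theta>)"
  using hysteresis_loop_two_boxD[OF assms] hysteresis_loop_two_box[OF assms] by blast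

section \<open>The regimes in the parameter plane\<close>

lemma forcing_folds_ordered:
  assumes "\<beta> > 0" "lam > 0" "3 / \<beta> < \<theta>\<^sup>2"
  shows "forcing \<beta> lam \<theta> (fold_hi \<beta> lam \<theta>) < forcing \<beta> lam \<theta> (fold_lo \<beta> lam \<theta>)"
  using hysteresis_loop_two_box[OF assms] by (simp add: hysteresis_loop_def)

theorem theorem10p1:
  fixes \<beta> lam \<theta>\<^sub>c P\<^sub>c :: real
  assumes "\<beta> > 0" and "lam > 0"
    and "\<theta>\<^sub>c = sqrt (3 / \<beta>)" and "P\<^sub>c = 8 / (3 * lam * sqrt (3 * \<beta>))"
  shows "{(\<theta>, P). 0 \<le> \<theta> \<and> cusp_bifurcation (two_box \<beta> lam) \<theta> P} = {(\<theta>\<^sub>c, P\<^sub>c)}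
    \<and> (\<forall>\<theta>\<ge>0. monotonically_stable (two_box \<beta> lam) \<theta> \<longleftrightarrow> \<theta> < \<theta>\<^sub>c)
    \<and> (\<forall>\<theta>\<ge>0. hysteretic (two_box \<beta> lam) \<theta> \<longleftrightarrow> \<theta>\<^sub>c < \<theta>)
    \<and> frontier (monotonic_regime (two_box \<beta> lam)) \<inter> frontier (hysteresis_regime (two_box \<beta> lam))
        = {(\<theta>\<^sub>c, P\<^sub>c)}"
proof -
  note pos = assms(1,2)
  have c_pos: "\<theta>\<^sub>c > 0" and c_sq: "\<theta>\<^sub>c\<^sup>2 = 3 / \<beta>" using assms by auto
  have sq_less: "\<theta>\<^sup>2 < 3 / \<beta> \<longleftrightarrow> \<theta> < \<theta>\<^sub>c" and sq_greater: "3 / \<beta> < \<theta>\<^sup>2 \<longleftrightarrow> \<theta>\<^sub>c < \<theta>"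
    and sq_eq: "\<theta>\<^sup>2 = 3 / \<beta> \<longleftrightarrow> \<theta> = \<theta>\<^sub>c" if "0 \<le> \<theta>" for \<theta>
    using that c_pos power_mono_iff[of \<theta> \<theta>\<^sub>c 2] power_mono_iff[of \<theta>\<^sub>c \<theta> 2]
    unfolding c_sq[symmetric] by linarith+
  have c_mult: "\<beta> * \<theta>\<^sub>c * \<theta>\<^sub>c = 3"
    using c_sq pos by (simp add: power2_eq_square mult.assoc)
  have Pc: "forcing \<beta> lam \<theta>\<^sub>c (2 * \<theta>\<^sub>c / (3 * lam)) = P\<^sub>c"
  proof -
    \<comment> \<open>Rewrites \<open>P\<^sub>c\<close> as a multiple of
      \<open>\<theta>\<^sub>c\<close>, using
      \<open>\<beta> * \<theta>\<^sub>c * \<theta>\<^sub>c = 3\<close>. At the inflection point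
      \<open>\<theta>\<^sub>c - lam * S = \<theta>\<^sub>c / 3\<close>, whence the 9 below.\<close>
    have "sqrt (3 * \<beta>) = \<beta> * \<theta>\<^sub>c"
      using pos c_pos c_mult
      by (intro real_sqrt_unique) (auto simp: power2_eq_square algebra_simps)
    then have "P\<^sub>c = 8 / (3 * lam * (\<beta> * \<theta>\<^sub>c))" by (simp add: assms(4))
    moreover have "8 / (3 * lam * (\<beta> * \<theta>\<^sub>c)) = 8 * \<theta>\<^sub>c / (9 * lam)"
      using pos c_pos c_mult by (simp add: field_simps)
    moreover have "forcing \<beta> lam \<theta>\<^sub>c (2 * \<theta>\<^sub>c / (3 * lam)) = 2 * \<theta>\<^sub>c / (3 * lam) * (1 + \<beta> * \<theta>\<^sub>c\<^sup>2 / 9)"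
      using pos by (simp add: forcing_def power2_eq_square)
    ultimately show ?thesis using pos by (simp add: c_sq)
  qed
  have cusp: "{(\<theta>, P). 0 \<le> \<theta> \<and> cusp_bifurcation (two_box \<beta> lam) \<theta> P} = {(\<theta>\<^sub>c, P\<^sub>c)}"
    unfolding cusp_bifurcation_two_box_iff[OF pos] using sq_eq Pc c_pos c_sq by auto
  have mono: "\<forall>\<theta>\<ge>0. monotonically_stable (two_box \<beta> lam) \<theta> \<longleftrightarrow> \<theta> < \<theta>\<^sub>c"
    using monotonically_stable_two_box_iff[OF pos] sq_less by blast
  have hyst: "\<forall>\<theta>\<ge>0. hysteretic (two_box \<beta> lam) \<theta> \<longleftrightarrow> \<theta>\<^sub>c < \<theta>"
    unfolding hysteretic_def hysteresis_loop_two_box_iff[OF pos] using sq_greater by blast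

  define plo phi where "plo = (\<lambda>\<theta>. forcing \<beta> lam \<theta> (fold_hi \<beta> lam \<theta>))"
    and "phi = (\<lambda>\<theta>. forcing \<beta> lam \<theta> (fold_lo \<beta> lam \<theta>))"
  have cont: "continuous_on A plo" "continuous_on A phi" for A
    unfolding plo_def phi_def forcing_def fold_lo_def fold_hi_def using pos
    by (auto intro!: continuous_intros)
  \<comment> \<open>At \<open>\<theta>\<^sub>c\<close> the square root vanishes and both folds sit
    at the inflection point.\<close>
  have merge: "plo \<theta>\<^sub>c = P\<^sub>c" "phi \<theta>\<^sub>c = P\<^sub>c"
    using Pc by (simp_all add: plo_def phi_def fold_lo_def fold_hi_def c_sq)
  have M: "monotonic_regime (two_box \<beta> lam) = {0..<\<theta>\<^sub>c} \<times> UNIV"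
    unfolding monotonic_regime_def using mono by auto
  let ?H = "hysteresis_regime (two_box \<beta> lam)"
  have H: "?H = {(\<theta>, P). \<theta>\<^sub>c < \<theta> \<and> plo \<theta> < P \<and> P < phi \<theta>}"
    unfolding hysteresis_regime_def hysteresis_loop_two_box_iff[OF pos] plo_def phi_def
    using sq_greater c_pos by (auto dest: less_trans)
  \<comment> \<open>The line \<open>\<theta> = 0\<close> appears because the regime is cut off at
    nonnegative \<theta>; the closure of the hysteresis regime stays away from it.\<close>
  have fM: "frontier (monotonic_regime (two_box \<beta> lam)) = {0, \<theta>\<^sub>c} \<times> UNIV"
    unfolding M frontier_def closure_Times interior_Times using c_pos by auto
  \<comment> \<open>The closed set on the right meets the line
    \<open>\<theta> = \<theta>\<^sub>c\<close> only where \<open>P\<close> lies between two equal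
    fold values.\<close>
  have closure_H: "closure ?H \<subseteq> {x. \<theta>\<^sub>c \<le> fst x \<and> plo (fst x) \<le> snd x \<and> snd x \<le> phi (fst x)}"
  proof (rule closure_minimal)
    have c: "continuous_on UNIV (\<lambda>x :: real \<times> real. plo (fst x))"
        "continuous_on UNIV (\<lambda>x :: real \<times> real. phi (fst x))"
      by (rule continuous_on_compose2[OF cont(1)[of UNIV]]
          continuous_on_compose2[OF cont(2)[of UNIV]], auto intro: continuous_on_fst)+
    show "closed {x. \<theta>\<^sub>c \<le> fst x \<and> plo (fst x) \<le> snd x \<and> snd x \<le> phi (fst x)}"
      by (intro closed_Collect_conj closed_Collect_le c continuous_intros)
  qed (auto simp: H)
  have cusp_closure: "(\<theta>\<^sub>c, P\<^sub>c) \<in> closure ?H"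
  proof -
    \<comment> \<open>The curve of midpoints between the fold values lies in the regime for
      \<open>\<theta> > \<theta>\<^sub>c\<close> and runs continuously into the cusp.\<close>
    let ?m = "\<lambda>\<theta>. (\<theta>, (plo \<theta> + phi \<theta>) / 2)"
    have "?m ` closure {\<theta>\<^sub>c<..} \<subseteq> closure ?H"
    proof (rule image_closure_subset)
      show "continuous_on (closure {\<theta>\<^sub>c<..}) ?m"
        by (intro continuous_intros cont) auto
      have "plo \<theta> < phi \<theta>" if "\<theta>\<^sub>c < \<theta>" for \<theta>
        using forcing_folds_ordered[OF pos] sq_greater[of \<theta>] that c_pos
        by (simp add: plo_def phi_def)
      then have "?m ` {\<theta>\<^sub>c<..} \<subseteq> ?H" by (auto simp: H)
      then show "?m ` {\<theta>\<^sub>c<..} \<subseteq> closure ?H" using closure_subset by blast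
    qed simp
    then have "?m \<theta>\<^sub>c \<in> closure ?H" by auto
    then show ?thesis by (simp add: merge)
  qed
  have "frontier (monotonic_regime (two_box \<beta> lam)) \<inter> frontier ?H = {(\<theta>\<^sub>c, P\<^sub>c)}"
  proof
    show "frontier (monotonic_regime (two_box \<beta> lam)) \<inter> frontier ?H \<subseteq> {(\<theta>\<^sub>c, P\<^sub>c)}"
      unfolding fM using closure_H merge c_pos by (fastforce simp: frontier_def)
    \<comment> \<open>The regime requires \<open>\<theta> > \<theta>\<^sub>c\<close> strictly, so
      the cusp is outside it and hence on its frontier.\<close>
    have "(\<theta>\<^sub>c, P\<^sub>c) \<notin> interior ?H" using interior_subset[of ?H] by (auto simp: H)
    then show "{(\<theta>\<^sub>c, P\<^sub>c)} \<subseteq> frontier (monotonic_regime (two_box \<beta> lam)) \<inter> frontier ?H"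
      unfolding fM using cusp_closure by (simp add: frontier_def)
  qed
  with cusp mono hyst show ?thesis by blast
qed

end
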